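(* Thomas, Janet and Pommaret divisions on the set $\mathbb{M}$ of monomials in $x_1,\dots,x_n$ are constructive.
   Context: $K$ is a field of characteristic zero, $\mathbb{M}$ is the monoid of monomials in $K[x_1,\dots,x_n]$, and $\deg_i(u)$ is the degree of $x_i$ in $u$. For each division $L$ below, each finite $U\subset\mathbb{M}$ and $u\in U$ determine the set $M_L(u,U)$ of multiplicative variables and the complementary set $NM_L(u,U)$ of non-multiplicative variables; $L(u,U)$ is the set of all monomials in the variables $M_L(u,U)$. For $u\in U$, $w\in\mathbb{M}$ one writes $u|_L w$ (w.r.t. $U$) if $w\in uL(u,U)$. The involutive cone of $U$ is $C_L(U)=\bigcup_{u\in U}u\,L(u,U)$. Thomas division: for finite $U$ let $h_i(U)=\max\{\deg_i(u)\mid u\in U\}$. The variable $x_i$ is multiplicative for $u\in U$ if $\deg_i(u)=h_i(U)$ and non-multiplicative otherwise. Janet division: for finite $U$, $1\le i\le n$ and non-negative integers $d_1,\dots,d_i$ let $[d_1,\dots,d_i]=\{u\in U\mid \deg_j(u)=d_j,\ 1\le j\le i\}$. The variable $x_i$ is multiplicative for $u\in U$ if $i=1$ and $\deg_1(u)=\max\{\deg_1(v)\mid v\in U\}$, or if $i>1$, $u\in[d_1,\dots,d_{i-1}]$ and $\deg_i(u)=\max\{\deg_i(v)\mid v\in[d_1,\dots,d_{i-1}]\}$; otherwise it is non-multiplicative. Pommaret division: for a monomial $u=x_1^{d_1}\cdots x_k^{d_k}$ with $d_k>0$ the variables $x_j$ with $j\ge k$ are multiplicative and those with $j<k$ are non-multiplicative;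 for $u=1$ all variables are multiplicative (independently of $U$). Continuity: $L$ is continuous if for any finite $U\subset\mathbb{M}$ and any finite sequence $u_1,\dots,u_k$ of elements of $U$ such that for every $i<k$ there is $x_j\in NM_L(u_i,U)$ with $u_{i+1}|_L(u_i\cdot x_j)$, one has $u_i\ne u_j$ for $i\neq j$. Constructivity: a continuous division $L$ is constructive if for any finite $U\subset\mathbb{M}$, any $u\in U$ and any $x_i\in NM_L(u,U)$ such that $u\cdot x_i\notin C_L(U)$ and such that for all $v\in U$ and all $x_j\in NM_L(v,U)$ with $v\cdot x_j\mid u\cdot x_i$ and $v\cdot x_j\neq u\cdot x_i$ one has $v\cdot x_j\in C_L(U)$, the following holds: for all $w\in C_L(U)$, $u\cdot x_i\notin w\,L(w,U\cup\{w\})$. *)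

theory Defs
  imports "HOL-Library.Poly_Mapping"
begin

text \<open>A monomial in \<open>x\<^sub>1, \<dots>, x\<^sub>n\<close> is represented by its exponent vector, a finitely supported map
  from the indices \<open>1, \<dots>, n\<close> to \<open>nat\<close>. The product of monomials is \<open>+\<close> and the
  unit monomial is \<open>0\<close>.\<close>

type_synonym mono = "nat \<Rightarrow>\<^sub>0 nat"

definition monomials :: "nat \<Rightarrow> mono set" where
  "monomials n = {u. Poly_Mapping.keys u \<subseteq> {1..n}}"

abbreviation deg :: "nat \<Rightarrow> mono \<Rightarrow> nat" where
  "deg i u \<equiv> Poly_Mapping.lookup u i"

definition var :: "nat \<Rightarrow> mono" where
  "var i = Poly_Mapping.single i 1"

definition mono_dvd :: "nat \<Rightarrow> mono \<Rightarrow> mono \<Rightarrow> bool" where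
  "mono_dvd n u w \<longleftrightarrow> (\<exists>t\<in>monomials n. w = u + t)"

text \<open>A division assigns to \<open>u\<close> and \<open>U\<close> the set \<open>M\<^sub>L(u, U)\<close> of indices of multiplicative variables.
  Its value is relevant only for finite \<open>U\<close> and \<open>u \<in> U\<close>.\<close>

type_synonym division = "mono \<Rightarrow> mono set \<Rightarrow> nat set"

definition nonmult :: "nat \<Rightarrow> division \<Rightarrow> mono \<Rightarrow> mono set \<Rightarrow> nat set" where
  "nonmult n L u U = {1..n} - L u U"

definition mult_monomials :: "nat \<Rightarrow> division \<Rightarrow> mono \<Rightarrow> mono set \<Rightarrow> mono set" where
  "mult_monomials n L u U = {t \<in> monomials n. Poly_Mapping.keys t \<subseteq> L u U}"

text \<open>\<open>mono_cone n L u U\<close> is \<open>u L(u, U)\<close>, and \<open>inv_dvd n L U u w\<close> is \<open>u |\<^sub>L w\<close> with respect to \<open>U\<close>.\<close>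

definition mono_cone :: "nat \<Rightarrow> division \<Rightarrow> mono \<Rightarrow> mono set \<Rightarrow> mono set" where
  "mono_cone n L u U = (\<lambda>t. u + t) ` mult_monomials n L u U"

definition inv_dvd :: "nat \<Rightarrow> division \<Rightarrow> mono set \<Rightarrow> mono \<Rightarrow> mono \<Rightarrow> bool" where
  "inv_dvd n L U u w \<longleftrightarrow> w \<in> mono_cone n L u U"

definition inv_cone :: "nat \<Rightarrow> division \<Rightarrow> mono set \<Rightarrow> mono set" where
  "inv_cone n L U = (\<Union>u\<in>U. mono_cone n L u U)"

definition thomas :: "nat \<Rightarrow> division" where
  "thomas n u U = {i \<in> {1..n}. deg i u = Max (deg i ` U)}"

text \<open>The class \<open>[d\<^sub>1, \<dots>, d\<^sub>i]\<close> in \<open>U\<close>, for the first \<open>i\<close> values of \<open>d\<close>. For \<open>i = 0\<close> it is \<open>U\<close> itself,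
  so that the two clauses of the Janet division (\<open>i = 1\<close> and \<open>i > 1\<close>) take the same form.\<close>

definition janet_class :: "mono set \<Rightarrow> nat \<Rightarrow> (nat \<Rightarrow> nat) \<Rightarrow> mono set" where
  "janet_class U i d = {u \<in> U. \<forall>j\<in>{1..i}. deg j u = d j}"

lemma janet_class_0 [simp]: "janet_class U 0 d = U"
  by (simp add: janet_class_def)

definition janet :: "nat \<Rightarrow> division" where
  "janet n u U =
    {i \<in> {1..n}. deg i u = Max (deg i ` janet_class U (i - 1) (\<lambda>j. deg j u))}"

definition pommaret :: "nat \<Rightarrow> division" where
  "pommaret n u U = (if u = 0 then {1..n} else {Max (Poly_Mapping.keys u)..n})"

definition continuous_division :: "nat \<Rightarrow> division \<Rightarrow> bool" where
  "continuous_division n L \<longleftrightarrow>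
    (\<forall>U us. finite U \<and> U \<subseteq> monomials n \<and> set us \<subseteq> U \<and>
      (\<forall>i. Suc i < length us \<longrightarrow>
        (\<exists>j\<in>nonmult n L (us ! i) U. inv_dvd n L U (us ! Suc i) (us ! i + var j)))
      \<longrightarrow> distinct us)"

definition constructive_division :: "nat \<Rightarrow> division \<Rightarrow> bool" where
  "constructive_division n L \<longleftrightarrow>
    continuous_division n L \<and>
    (\<forall>U u i. finite U \<and> U \<subseteq> monomials n \<and> u \<in> U \<and> i \<in> nonmult n L u U \<and>
      u + var i \<notin> inv_cone n L U \<and>
      (\<forall>v\<in>U. \<forall>j\<in>nonmult n L v U.
        mono_dvd n (v + var j) (u + var i) \<and> v + var j \<noteq> u + var i
          \<longrightarrow> v + var j \<in> inv_cone n L U)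
      \<longrightarrow> (\<forall>w\<in>inv_cone n L U. u + var i \<notin> mono_cone n L w (U \<union> {w})))"

end

theory Submission
  imports Defs
begin

text \<open>
  Everything rests on what happens when a non-multiplicative prolongation \<open>u + var i\<close> lies in
  the cone of another element \<open>v\<close>. For Thomas division this forces \<open>v = u + var i\<close>, because the
  prolongation does not exceed the maximal degrees and so leaves no room for a nontrivial
  multiplicative cofactor. For Janet division \<open>v\<close> agrees with \<open>u\<close> in the variables before
  \<open>x\<^sub>i\<close> and has one more \<open>x\<^sub>i\<close>. For Pommaret division either the last variable of \<open>v\<close> comes
  before the one of \<open>u\<close>, or both have the same last variable and \<open>v\<close> is lexicographically
  larger. So each chain in the definition of continuity strictly increases for some order,
  hence has no repetitions. The lexicographic order (\<open>x\<^sub>1 > x\<^sub>2 > \<dots>\<close>) is the order \<open><\<close> on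
  \<open>nat \<Rightarrow>\<^sub>0 nat\<close>.

  Now suppose, against constructivity, that \<open>u + var i = w + t\<close> where \<open>w = v + s\<close> with
  \<open>v \<in> U\<close>, \<open>s\<close> is multiplicative for \<open>v\<close>, and \<open>t\<close> is multiplicative for \<open>w\<close> once \<open>w\<close> is added
  to \<open>U\<close>. For Pommaret division \<open>t\<close> is then multiplicative for \<open>v\<close> as well, so the prolongation
  is in the cone of \<open>v\<close>. For Thomas division, adding \<open>w\<close> leaves \<open>x\<^sub>i\<close> non-multiplicative for \<open>u\<close>,
  and the fact above gives \<open>w = u + var i\<close>, which is in the involutive cone of \<open>U\<close>.

  For Janet division the hypothesis on smaller prolongations drives an ascent inside \<open>U\<close>. If
  \<open>s = 0\<close>, then \<open>w \<in> U\<close> and adding \<open>w\<close> changes nothing. Otherwise let \<open>x\<^sub>m\<close> be the first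
  variable of \<open>s\<close>. Among the elements of \<open>U\<close> that divide \<open>u + var i\<close> and agree with \<open>v\<close> up to
  \<open>x\<^sub>m\<close>, take the lexicographically largest one, \<open>y\<close>. Some variable \<open>x\<^sub>j\<close> of the cofactor of \<open>y\<close>
  is non-multiplicative for \<open>y\<close>, and comparison with \<open>v\<close> and \<open>w\<close> shows \<open>j > m\<close>. As \<open>x\<^sub>m\<close> still
  divides the cofactor, \<open>y + var j\<close> is a smaller prolongation, so it lies in the cone of some
  element of \<open>U\<close>; that element contradicts the choice of \<open>y\<close>.
\<close>

section \<open>Cones and continuity\<close>

text \<open>Phrasing multiplicative cofactors through the non-multiplicative variables makes the
  three divisions uniform: in each of them, being non-multiplicative has a simple witness.\<close>

lemma mono_cone_iff:
  "w \<in> mono_cone n L v U \<longleftrightarrow>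
    (\<exists>t\<in>monomials n. w = v + t \<and> (\<forall>k\<in>nonmult n L v U. deg k t = 0))"
proof -
  have "Poly_Mapping.keys t \<subseteq> L v U \<longleftrightarrow> (\<forall>k\<in>nonmult n L v U. deg k t = 0)"
    if "t \<in> monomials n" for t
    using that unfolding monomials_def nonmult_def subset_iff in_keys_iff mem_Collect_eq Ball_def
    by (metis Diff_iff)
  then show ?thesis
    unfolding mono_cone_def mult_monomials_def image_iff Bex_def mem_Collect_eq by metis
qed

lemma nonmult_subset: "nonmult n L u U \<subseteq> {1..n}"
  by (auto simp: nonmult_def)

lemma deg_var: "deg k (var i) = (if k = i then 1 else 0)"
  by (simp add: var_def lookup_single when_def)

lemma deg_0_monomials: "u \<in> monomials n \<Longrightarrow> deg 0 u = 0"
  by (auto simp: monomials_def in_keys_iff subset_iff)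

lemma monomials_add: "u \<in> monomials n \<Longrightarrow> t \<in> monomials n \<Longrightarrow> u + t \<in> monomials n"
  using keys_add[of u t] by (auto simp: monomials_def)

lemma var_monomials: "i \<in> {1..n} \<Longrightarrow> var i \<in> monomials n"
  by (auto simp: monomials_def var_def)

lemma mono_dvd_iff:
  assumes "w \<in> monomials n"
  shows "mono_dvd n u w \<longleftrightarrow> (\<forall>k. deg k u \<le> deg k w)"
proof
  assume "mono_dvd n u w"
  then show "\<forall>k. deg k u \<le> deg k w" by (auto simp: mono_dvd_def lookup_add)
next
  assume le: "\<forall>k. deg k u \<le> deg k w"
  have "w = u + (w - u)"
    using le by (intro poly_mapping_eqI) (simp add: lookup_add lookup_minus)
  moreover have "w - u \<in> monomials n"
    using assms by (auto simp: monomials_def subset_iff in_keys_iff lookup_minus)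
  ultimately show "mono_dvd n u w" unfolding mono_dvd_def by blast
qed

lemma lex_lessI:
  fixes u v :: mono
  assumes "\<And>k. k < i \<Longrightarrow> deg k u = deg k v" "deg i u < deg i v"
  shows "u < v"
  using assms by (auto simp: less_poly_mapping.rep_eq less_fun_def)

text \<open>A chain that strictly increases for a transitive irreflexive relation cannot repeat.\<close>

lemma continuous_divisionI:
  assumes "transp R" "irreflp R"
    and step: "\<And>U u v j. finite U \<Longrightarrow> U \<subseteq> monomials n \<Longrightarrow> u \<in> U \<Longrightarrow> v \<in> U \<Longrightarrow>
      j \<in> nonmult n L u U \<Longrightarrow> u + var j \<in> mono_cone n L v U \<Longrightarrow> R u v"
  shows "continuous_division n L"
  unfolding continuous_division_def inv_dvd_def
proof (intro allI impI, elim conjE)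
  fix U us
  assume U: "finite U" "U \<subseteq> monomials n" "set us \<subseteq> U"
    and chain: "\<forall>i. Suc i < length us \<longrightarrow>
      (\<exists>j\<in>nonmult n L (us ! i) U. us ! i + var j \<in> mono_cone n L (us ! Suc i) U)"
  have "R (us ! i) (us ! Suc i)" if "Suc i < length us" for i
  proof -
    have "us ! i \<in> U" "us ! Suc i \<in> U" using that U(3) by (auto simp: subset_iff)
    then show ?thesis using chain that step[OF U(1,2)] by blast
  qed
  then have "sorted_wrt R us"
    using assms(1) by (simp add: sorted_wrt_iff_nth_Suc_transp)
  then show "distinct us"
    using assms(2) by (induction us) (auto simp: irreflp_def)
qed

section \<open>Thomas division\<close>

lemma nonmult_thomas_iff:
  assumes "finite U" "u \<in> U"
  shows "i \<in> nonmult n (thomas n) u U \<longleftrightarrow> i \<in> {1..n} \<and> (\<exists>z\<in>U. deg i u < deg i z)"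
proof -
  have "deg i u \<le> Max (deg i ` U)" using assms by simp
  moreover have "deg i u < Max (deg i ` U) \<longleftrightarrow> (\<exists>z\<in>U. deg i u < deg i z)"
    using assms by (subst Max_gr_iff) auto
  ultimately show ?thesis by (auto simp: nonmult_def thomas_def)
qed

lemma thomas_prolongation_in_cone:
  assumes U: "finite U" "u \<in> U" "v \<in> U"
    and i: "i \<in> nonmult n (thomas n) u U"
    and cone: "u + var i \<in> mono_cone n (thomas n) v U"
  shows "v = u + var i"
proof -
  obtain t where t: "t \<in> monomials n" "u + var i = v + t"
      "\<And>k. k \<in> nonmult n (thomas n) v U \<Longrightarrow> deg k t = 0"
    using cone by (auto simp: mono_cone_iff)
  obtain z where z: "z \<in> U" "deg i u < deg i z"
    using i U by (auto simp: nonmult_thomas_iff)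
  have "deg k t = 0" for k
  proof (rule ccontr)
    assume "deg k t \<noteq> 0"
    then have "k \<in> {1..n}" "k \<notin> nonmult n (thomas n) v U"
      using t by (auto simp: monomials_def in_keys_iff subset_iff)
    then have max: "deg k y \<le> deg k v" if "y \<in> U" for y
      using that U by (auto simp: nonmult_thomas_iff not_less)
    have "deg k u + deg k (var i) = deg k v + deg k t"
      using arg_cong[OF t(2), of "deg k"] by (simp add: lookup_add)
    then show False
      using max[OF U(2)] max[OF z(1)] z(2) \<open>deg k t \<noteq> 0\<close>
      by (auto simp: deg_var split: if_splits)
  qed
  then have "t = 0" by (intro poly_mapping_eqI) simp
  then show ?thesis using t(2) by simp
qed

lemma constructive_thomas: "constructive_division n (thomas n)"
  unfolding constructive_division_def
proof (intro conjI allI impI ballI notI; (elim conjE)?)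
  show "continuous_division n (thomas n)"
  proof (rule continuous_divisionI[where R = "(<)"])
    fix U u v j
    assume "finite U" "u \<in> U" "v \<in> U" "j \<in> nonmult n (thomas n) u U"
      "u + var j \<in> mono_cone n (thomas n) v U"
    then have "v = u + var j" by (rule thomas_prolongation_in_cone)
    then show "u < v" by (auto intro!: lex_lessI[of j] simp: lookup_add deg_var)
  qed (auto simp: irreflp_def)
next
  fix U u i w
  assume U: "finite U" "u \<in> U" and i: "i \<in> nonmult n (thomas n) u U"
    and notin: "u + var i \<notin> inv_cone n (thomas n) U"
    and w: "w \<in> inv_cone n (thomas n) U"
    and cone: "u + var i \<in> mono_cone n (thomas n) w (U \<union> {w})"
  have "i \<in> nonmult n (thomas n) u (U \<union> {w})"
    using i U by (auto simp: nonmult_thomas_iff)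
  then have "w = u + var i"
    using U cone by (intro thomas_prolongation_in_cone[of "U \<union> {w}"]) auto
  then show False using w notin by simp
qed

section \<open>Janet division\<close>

text \<open>A variable is non-multiplicative for \<open>u\<close> exactly if some element of the same class beats
  \<open>u\<close> in it. Such a witness survives when \<open>U\<close> grows, and it can be transported between
  members of one class.\<close>

lemma nonmult_janet_iff:
  assumes "finite U" "U \<subseteq> monomials n" "u \<in> U"
  shows "i \<in> nonmult n (janet n) u U \<longleftrightarrow>
    i \<in> {1..n} \<and> (\<exists>z\<in>U. (\<forall>k<i. deg k z = deg k u) \<and> deg i u < deg i z)"
proof -
  define C where "C = janet_class U (i - 1) (\<lambda>j. deg j u)"
  have C: "finite C" "u \<in> C" using assms by (auto simp: C_def janet_class_def)
  have "deg i u \<le> Max (deg i ` C)" using C by simp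
  moreover have "deg i u < Max (deg i ` C) \<longleftrightarrow> (\<exists>z\<in>C. deg i u < deg i z)"
    using C by (subst Max_gr_iff) auto
  moreover have "z \<in> C \<longleftrightarrow> z \<in> U \<and> (\<forall>k<i. deg k z = deg k u)" if "i \<in> {1..n}" for z
  proof -
    \<comment> \<open>The index \<open>0\<close> is harmless because it does not occur in monomials.\<close>
    have "deg 0 z = deg 0 u" if "z \<in> U"
      using that assms deg_0_monomials by (metis subsetD)
    moreover have "k < i \<longleftrightarrow> k = 0 \<or> k \<in> {1..i - 1}" for k
      using that by auto
    ultimately show ?thesis unfolding C_def janet_class_def mem_Collect_eq by metis
  qed
  moreover have "i \<in> nonmult n (janet n) u U \<longleftrightarrow> i \<in> {1..n} \<and> deg i u \<noteq> Max (deg i ` C)"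
    unfolding nonmult_def janet_def C_def by blast
  ultimately show ?thesis by (metis nat_less_le)
qed

text \<open>Before \<open>x\<^sub>i\<close>, a deficit of \<open>v\<close> against \<open>u\<close> would have to be made up multiplicatively,
  although \<open>u\<close>, being in the same class as \<open>v\<close>, beats \<open>v\<close> there. At \<open>x\<^sub>i\<close> the element that makes
  \<open>x\<^sub>i\<close> non-multiplicative for \<open>u\<close> plays this part.\<close>

lemma janet_prolongation_in_cone:
  assumes U: "finite U" "U \<subseteq> monomials n" "u \<in> U" "v \<in> U"
    and i: "i \<in> nonmult n (janet n) u U"
    and cone: "u + var i \<in> mono_cone n (janet n) v U"
  shows "(\<forall>k<i. deg k v = deg k u) \<and> deg i v = deg i u + 1"
proof -
  obtain t where t: "t \<in> monomials n" "u + var i = v + t"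
      "\<And>k. k \<in> nonmult n (janet n) v U \<Longrightarrow> deg k t = 0"
    using cone by (auto simp: mono_cone_iff)
  have eq: "deg k u + deg k (var i) = deg k v + deg k t" for k
    using arg_cong[OF t(2), of "deg k"] by (simp add: lookup_add)
  have no_cofactor: "deg k t = 0"
    if "\<forall>l<k. deg l z = deg l v" "deg k v < deg k z" "z \<in> U" for k z
  proof (cases "k \<in> {1..n}")
    case True
    then show ?thesis using that U by (intro t(3)) (auto simp: nonmult_janet_iff)
  next
    case False
    then show ?thesis using t(1) by (auto simp: monomials_def in_keys_iff)
  qed
  have below: "deg k v = deg k u" if "k < i" for k
    using that
  proof (induction k rule: less_induct)
    case (less k)
    have "\<forall>l<k. deg l u = deg l v" using less by simp
    then show ?case
      using no_cofactor[of k u] U(3) eq[of k] less.prems by (auto simp: deg_var)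
  qed
  obtain z where z: "z \<in> U" "\<forall>k<i. deg k z = deg k u" "deg i u < deg i z"
    using i U by (auto simp: nonmult_janet_iff)
  have "deg i v = deg i u + 1"
    using no_cofactor[of i z] z below eq[of i] by (cases "deg i v < deg i z") (auto simp: deg_var)
  then show ?thesis using below by blast
qed

lemma constructive_janet: "constructive_division n (janet n)"
  unfolding constructive_division_def
proof (intro conjI allI impI ballI notI; (elim conjE)?)
  show "continuous_division n (janet n)"
  proof (rule continuous_divisionI[where R = "(<)"])
    fix U u v j
    assume "finite U" "U \<subseteq> monomials n" "u \<in> U" "v \<in> U" "j \<in> nonmult n (janet n) u U"
      "u + var j \<in> mono_cone n (janet n) v U"
    from janet_prolongation_in_cone[OF this] show "u < v" by (auto intro!: lex_lessI[of j])
  qed (auto simp: irreflp_def)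
next
  fix U u i w
  assume U: "finite U" "U \<subseteq> monomials n" "u \<in> U" and i: "i \<in> nonmult n (janet n) u U"
    and notin: "u + var i \<notin> inv_cone n (janet n) U"
    and smaller: "\<forall>v\<in>U. \<forall>j\<in>nonmult n (janet n) v U.
      mono_dvd n (v + var j) (u + var i) \<and> v + var j \<noteq> u + var i
        \<longrightarrow> v + var j \<in> inv_cone n (janet n) U"
    and w: "w \<in> inv_cone n (janet n) U"
    and cone: "u + var i \<in> mono_cone n (janet n) w (U \<union> {w})"
  define p where "p = u + var i"
  have p: "p \<in> monomials n"
    unfolding p_def using U i nonmult_subset by (blast intro: monomials_add var_monomials)
  obtain v where v: "v \<in> U" "w \<in> mono_cone n (janet n) v U"
    using w by (auto simp: inv_cone_def)
  then obtain s where s: "s \<in> monomials n" "w = v + s"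
      "\<And>k. k \<in> nonmult n (janet n) v U \<Longrightarrow> deg k s = 0"
    by (auto simp: mono_cone_iff)
  obtain t where t: "t \<in> monomials n" "p = w + t"
      "\<And>k. k \<in> nonmult n (janet n) w (U \<union> {w}) \<Longrightarrow> deg k t = 0"
    using cone unfolding p_def by (auto simp: mono_cone_iff)
  have deg_p: "deg k p = deg k v + deg k s + deg k t" for k
    by (simp add: t(2) s(2) lookup_add)
  have U': "finite (U \<union> {w})" "U \<union> {w} \<subseteq> monomials n"
    using U v(1) s monomials_add by auto

  \<comment> \<open>If \<open>s\<close> is trivial, then \<open>w\<close> is already in \<open>U\<close> and its cone does not change.\<close>
  have "s \<noteq> 0"
  proof
    assume "s = 0"
    then have "w \<in> U" using s v by simp
    then have "U \<union> {w} = U" by blast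
    then show False using cone notin \<open>w \<in> U\<close> by (auto simp: inv_cone_def)
  qed
  define m where "m = (LEAST k. deg k s \<noteq> 0)"
  have "\<exists>k. deg k s \<noteq> 0" using \<open>s \<noteq> 0\<close> by (auto simp: poly_mapping_eq_iff fun_eq_iff)
  then have m: "deg m s \<noteq> 0" unfolding m_def by (rule LeastI_ex)
  have below_m: "deg k s = 0" if "k < m" for k
    using that not_less_Least[of k "\<lambda>k. deg k s \<noteq> 0"] by (simp add: m_def)

  define Y where "Y = {y\<in>U. (\<forall>k\<le>m. deg k y = deg k v) \<and> (\<forall>k. deg k y \<le> deg k p)}"
  have "finite Y" using U by (simp add: Y_def)
  have "v \<in> Y" using v(1) by (simp add: Y_def deg_p)
  define y where "y = Max Y"
  have y: "y \<in> Y"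
    unfolding y_def using \<open>finite Y\<close> \<open>v \<in> Y\<close> by (intro Max_in) auto
  have y_max: "y' \<le> y" if "y' \<in> Y" for y'
    unfolding y_def using \<open>finite Y\<close> that by (rule Max_ge)
  have yU: "y \<in> U" and y_v: "\<And>k. k \<le> m \<Longrightarrow> deg k y = deg k v"
    and y_p: "\<And>k. deg k y \<le> deg k p"
    using y by (auto simp: Y_def)
  have "mono_dvd n y p" using y_p p by (simp add: mono_dvd_iff)
  then obtain q where q: "q \<in> monomials n" "p = y + q" by (auto simp: mono_dvd_def)
  have deg_q: "deg k p = deg k y + deg k q" for k by (simp add: q(2) lookup_add)
  have "p \<notin> mono_cone n (janet n) y U"
    using notin yU by (auto simp: inv_cone_def p_def)
  then obtain j where j: "j \<in> nonmult n (janet n) y U" "deg j q \<noteq> 0"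
    using q by (auto simp: mono_cone_iff)

  \<comment> \<open>Up to \<open>x\<^sub>m\<close>, non-multiplicativity for \<open>y\<close> transfers to \<open>v\<close>, so such an \<open>x\<^sub>j\<close> would come
    from \<open>t\<close>; then it precedes \<open>x\<^sub>m\<close>, where \<open>v\<close> and \<open>w\<close> coincide, so it would also be
    non-multiplicative for \<open>w\<close>.\<close>
  have "m < j"
  proof (rule ccontr)
    assume "\<not> m < j"
    then have jm: "j \<le> m" by simp
    obtain z where z: "z \<in> U" "\<forall>k<j. deg k z = deg k y" "deg j y < deg j z" and jn: "j \<in> {1..n}"
      using j(1) U yU by (auto simp: nonmult_janet_iff)
    have "\<forall>k<j. deg k z = deg k v" "deg j v < deg j z"
      using z y_v jm by auto
    then have "j \<in> nonmult n (janet n) v U"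
      using z(1) jn U v(1) by (auto simp: nonmult_janet_iff)
    then have "deg j s = 0" by (rule s(3))
    then have "j < m" using m jm by (metis le_neq_implies_less)
    then have "\<forall>k\<le>j. deg k w = deg k v" using below_m by (simp add: s(2) lookup_add)
    then have "j \<in> nonmult n (janet n) w (U \<union> {w})"
      using \<open>\<forall>k<j. deg k z = deg k v\<close> \<open>deg j v < deg j z\<close> z(1) jn U'
      by (auto simp: nonmult_janet_iff)
    then have "deg j t = 0" by (rule t(3))
    then show False
      using \<open>deg j s = 0\<close> deg_p[of j] deg_q[of j] y_v[OF jm] j(2) by simp
  qed

  have "deg k (y + var j) \<le> deg k p" for k
    using j(2) deg_q[of k] by (auto simp: lookup_add deg_var)
  then have "mono_dvd n (y + var j) p" using p by (simp add: mono_dvd_iff)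
  moreover have "y + var j \<noteq> p"
  proof
    assume "y + var j = p"
    then have "deg m y = deg m p"
      using \<open>m < j\<close> by (metis add.right_neutral deg_var less_irrefl lookup_add)
    then show False using deg_p[of m] y_v[of m] m by simp
  qed
  ultimately have "y + var j \<in> inv_cone n (janet n) U"
    using smaller yU j(1) by (auto simp: p_def)
  then obtain y' where y': "y' \<in> U" "y + var j \<in> mono_cone n (janet n) y' U"
    by (auto simp: inv_cone_def)
  have y'_y: "\<forall>k<j. deg k y' = deg k y" "deg j y' = deg j y + 1"
    using janet_prolongation_in_cone[OF U(1,2) yU y'(1) j(1) y'(2)] by auto
  obtain r where "y + var j = y' + r" using y'(2) by (auto simp: mono_cone_iff)
  then have "deg k y' \<le> deg k (y + var j)" for k by (simp only: lookup_add le_add1)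
  then have "deg k y' \<le> deg k p" for k
    using \<open>\<And>k. deg k (y + var j) \<le> deg k p\<close> le_trans by blast
  then have "y' \<in> Y" using y'(1) y'_y(1) y_v \<open>m < j\<close> by (auto simp: Y_def)
  moreover have "y < y'" using y'_y by (auto intro!: lex_lessI[of j])
  ultimately show False using y_max[of y'] by simp
qed

section \<open>Pommaret division\<close>

text \<open>The value \<open>0\<close> for the unit monomial makes all variables \<open>x\<^sub>i\<close> with \<open>i \<ge> last_var u\<close>
  multiplicative without exception.\<close>

definition last_var :: "mono \<Rightarrow> nat" where
  "last_var u = Max (insert 0 (Poly_Mapping.keys u))"

lemma last_var_le_iff: "last_var u \<le> b \<longleftrightarrow> (\<forall>k. deg k u \<noteq> 0 \<longrightarrow> k \<le> b)"
  by (auto simp: last_var_def in_keys_iff)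

lemma nonmult_pommaret_iff:
  "i \<in> nonmult n (pommaret n) u U \<longleftrightarrow> i \<in> {1..n} \<and> i < last_var u"
proof (cases "u = 0")
  case False
  define M where "M = Max (Poly_Mapping.keys u)"
  have "last_var u = M" using False by (simp add: last_var_def M_def)
  then show ?thesis using False by (auto simp: nonmult_def pommaret_def M_def[symmetric])
qed (simp add: nonmult_def pommaret_def last_var_def)

lemma mono_cone_pommaret_iff:
  "w \<in> mono_cone n (pommaret n) v U \<longleftrightarrow>
    (\<exists>t\<in>monomials n. w = v + t \<and> (\<forall>k<last_var v. deg k t = 0))"
proof -
  have "(\<forall>k\<in>nonmult n (pommaret n) v U. deg k t = 0) \<longleftrightarrow> (\<forall>k<last_var v. deg k t = 0)"
    if "t \<in> monomials n" for t
  proof -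
    have "deg k t = 0" if "k \<notin> {1..n}" for k
      using \<open>t \<in> monomials n\<close> that unfolding monomials_def
      by (metis in_keys_iff mem_Collect_eq subsetD)
    then show ?thesis unfolding Ball_def nonmult_pommaret_iff by blast
  qed
  then show ?thesis by (auto simp: mono_cone_iff)
qed

lemma last_var_mono: "(\<And>k. deg k u \<le> deg k v) \<Longrightarrow> last_var u \<le> last_var v"
proof -
  assume le: "\<And>k. deg k u \<le> deg k v"
  have "k \<le> last_var v" if "deg k u \<noteq> 0" for k
    using that le[of k] last_var_le_iff[of v "last_var v"] by auto
  then show ?thesis by (simp add: last_var_le_iff)
qed

text \<open>The lexicographic order alone does not increase: with \<open>u = x\<^sub>1 x\<^sub>3\<close>, the prolongation
  \<open>x\<^sub>1 x\<^sub>2 x\<^sub>3\<close> lies in the cone of \<open>x\<^sub>1\<close>. In such cases the last variable becomes an earlier one.\<close>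

lemma pommaret_prolongation_in_cone:
  assumes i: "i \<in> nonmult n (pommaret n) u U"
    and cone: "u + var i \<in> mono_cone n (pommaret n) v U"
  shows "last_var v < last_var u \<or> last_var v = last_var u \<and> u < v"
proof -
  obtain t where t: "u + var i = v + t" "\<And>k. k < last_var v \<Longrightarrow> deg k t = 0"
    using cone by (auto simp: mono_cone_pommaret_iff)
  have eq: "deg k u + deg k (var i) = deg k v + deg k t" for k
    using arg_cong[OF t(1), of "deg k"] by (simp add: lookup_add)
  have i': "i < last_var u" using i by (simp add: nonmult_pommaret_iff)
  have "k \<le> last_var u" if "deg k v \<noteq> 0" for k
    using that eq[of k] i' last_var_le_iff[of u "last_var u"]
    by (cases "k = i") (auto simp: deg_var)
  then have "last_var v \<le> last_var u" by (simp add: last_var_le_iff)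
  moreover have "u < v" if "last_var v = last_var u"
  proof (rule lex_lessI[of i])
    show "deg k u = deg k v" if "k < i" for k
      using that eq[of k] t(2)[of k] i' \<open>last_var v = last_var u\<close> by (simp add: deg_var)
    show "deg i u < deg i v"
      using eq[of i] t(2)[of i] i' that by (simp add: deg_var)
  qed
  ultimately show ?thesis by auto
qed

lemma constructive_pommaret: "constructive_division n (pommaret n)"
  unfolding constructive_division_def
proof (intro conjI allI impI ballI notI; (elim conjE)?)
  show "continuous_division n (pommaret n)"
  proof -
    let ?R = "\<lambda>u v. last_var v < last_var u \<or> last_var v = last_var u \<and> u < v"
    have "transp ?R" by (rule transpI) auto
    moreover have "irreflp ?R" by (rule irreflpI) auto
    ultimately show ?thesis
      by (rule continuous_divisionI) (rule pommaret_prolongation_in_cone)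
  qed
next
  fix U u i w
  assume notin: "u + var i \<notin> inv_cone n (pommaret n) U"
    and w: "w \<in> inv_cone n (pommaret n) U"
    and cone: "u + var i \<in> mono_cone n (pommaret n) w (U \<union> {w})"
  obtain v s where v: "v \<in> U" and s: "s \<in> monomials n" "w = v + s"
      "\<forall>k<last_var v. deg k s = 0"
    using w by (auto simp: inv_cone_def mono_cone_pommaret_iff)
  obtain t where t: "t \<in> monomials n" "u + var i = w + t" "\<forall>k<last_var w. deg k t = 0"
    using cone by (auto simp: mono_cone_pommaret_iff)
  have "last_var v \<le> last_var w" by (rule last_var_mono) (simp add: s(2) lookup_add)
  then have "\<forall>k<last_var v. deg k (s + t) = 0" using s(3) t(3) by (simp add: lookup_add)
  moreover have "u + var i = v + (s + t)" by (simp add: t(2) s(2) add.assoc)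
  ultimately have "u + var i \<in> mono_cone n (pommaret n) v U"
    using s(1) t(1) by (auto simp: mono_cone_pommaret_iff intro: monomials_add)
  then show False using notin v by (auto simp: inv_cone_def)
qed

theorem proposition4p13:
  fixes n :: nat
  shows "constructive_division n (thomas n) \<and> constructive_division n (janet n) \<and>
    constructive_division n (pommaret n)"
  using constructive_thomas constructive_janet constructive_pommaret by blast

end
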